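(* For any function $D=D(n)\leq n^{o(1)}$ and any deterministic exploration strategy using $k=\Theta(n)$ agents, the competitive ratio of the strategy on the set of all rooted trees with $n$ vertices and height at least $D$ is $\omega(1)$ (i.e. tends to infinity as $n\to\infty$).
   Context: Collaborative tree exploration: a rooted tree is initially unknown; $k$ agents start at the root; in synchronous rounds each agent stays or moves along an edge incident to its current vertex; edges incident to a vertex are revealed when it is first visited; agents communicate globally, have unlimited memory and computation; strategies are deterministic. Exploration is complete once all vertices are visited. The height of a rooted tree is the maximum distance from the root to a vertex. The competitive ratio on a class of trees is the worst case over trees in the class of the ratio between the number of rounds the strategy needs and the offline optimum, i.e. the minimum number of rounds for $k$ agents starting at the root to visit all vertices when the tree is known in advance. *)

theory Defs
  imports Complex_Main "HOL-Library.Landau_Symbols" "HOL-Library.Extended_Nonnegative_Real"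
begin

(* Undirected graphs are symmetric irreflexive relations.  Vertices are natural numbers and are
   visible to the agents; a class of trees below always contains all relabellings of its members,
   so the worst case is also taken over the names of the vertices. *)
record rooted_graph =
  verts :: "nat set"
  edges :: "(nat \<times> nat) set"
  root :: nat

definition is_cycle :: "(nat \<times> nat) set \<Rightarrow> nat list \<Rightarrow> bool" where
  "is_cycle E p \<longleftrightarrow>
     length p \<ge> 3 \<and> distinct p \<and> successively (\<lambda>u v. (u, v) \<in> E) p \<and> (last p, hd p) \<in> E"

definition rooted_tree :: "rooted_graph \<Rightarrow> bool" where
  "rooted_tree T \<longleftrightarrow>
     finite (verts T) \<and> root T \<in> verts T \<and>
     edges T \<subseteq> verts T \<times> verts T \<and> sym (edges T) \<and> irrefl (edges T) \<and>
     (\<forall>u\<in>verts T. \<forall>v\<in>verts T. (u, v) \<in> (edges T)\<^sup>*) \<and>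
     (\<nexists>p. is_cycle (edges T) p)"

definition distance :: "rooted_graph \<Rightarrow> nat \<Rightarrow> nat \<Rightarrow> nat" where
  "distance T u v = (LEAST m. (u, v) \<in> edges T ^^ m)"

definition height :: "rooted_graph \<Rightarrow> nat" where
  "height T = Max (distance T (root T) ` verts T)"

definition trees_of_size_height :: "nat \<Rightarrow> real \<Rightarrow> rooted_graph set" where
  "trees_of_size_height n d = {T. rooted_tree T \<and> card (verts T) = n \<and> d \<le> real (height T)}"

(* The i-th entry is the current vertex of the i-th agent. *)
type_synonym configuration = "nat list"

definition legal_round :: "(nat \<times> nat) set \<Rightarrow> configuration \<Rightarrow> configuration \<Rightarrow> bool" where
  "legal_round E = list_all2 (\<lambda>u v. u = v \<or> (u, v) \<in> E)"

definition legal_schedule :: "nat \<Rightarrow> rooted_graph \<Rightarrow> (nat \<Rightarrow> configuration) \<Rightarrow> bool" where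
  "legal_schedule k T X \<longleftrightarrow>
     X 0 = replicate k (root T) \<and> (\<forall>t. legal_round (edges T) (X t) (X (Suc t)))"

(* The value is infinite if some vertex is never visited. *)
definition exploration_time :: "rooted_graph \<Rightarrow> (nat \<Rightarrow> configuration) \<Rightarrow> enat" where
  "exploration_time T X = Inf {enat t | t. verts T \<subseteq> (\<Union>s\<le>t. set (X s))}"

definition offline_optimum :: "nat \<Rightarrow> rooted_graph \<Rightarrow> enat" where
  "offline_optimum k T = Inf {exploration_time T X | X. legal_schedule k T X}"

(* A strategy maps the list of all configurations so far (oldest first, the current one last) and
   the edges revealed so far to the next configuration.  What had been revealed at earlier times
   can be recovered from these data. *)
type_synonym strategy = "configuration list \<Rightarrow> (nat \<times> nat) set \<Rightarrow> configuration"

definition exploration_strategy :: "nat \<Rightarrow> strategy \<Rightarrow> bool" where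
  "exploration_strategy k S \<longleftrightarrow>
     (\<forall>h R. h \<noteq> [] \<longrightarrow> length (last h) = k \<longrightarrow> legal_round R (last h) (S h R))"

definition revealed :: "rooted_graph \<Rightarrow> configuration list \<Rightarrow> (nat \<times> nat) set" where
  "revealed T h = {(u, v) \<in> edges T. \<exists>c\<in>set h. u \<in> set c \<or> v \<in> set c}"

primrec history :: "nat \<Rightarrow> strategy \<Rightarrow> rooted_graph \<Rightarrow> nat \<Rightarrow> configuration list" where
  "history k S T 0 = [replicate k (root T)]"
| "history k S T (Suc t) = history k S T t @ [S (history k S T t) (revealed T (history k S T t))]"

definition run :: "nat \<Rightarrow> strategy \<Rightarrow> rooted_graph \<Rightarrow> nat \<Rightarrow> configuration" where
  "run k S T t = last (history k S T t)"

definition competitive_ratio :: "nat \<Rightarrow> strategy \<Rightarrow> rooted_graph set \<Rightarrow> ennreal" where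
  "competitive_ratio k S C =
     (SUP T\<in>C. ennreal_of_enat (exploration_time T (run k S T)) /
               ennreal_of_enat (offline_optimum k T))"

lemma legal_schedule_run:
  assumes "exploration_strategy k S"
  shows "legal_schedule k T (run k S T)"
proof -
  have ne: "history k S T t \<noteq> []" for t by (induction t) auto
  have step: "legal_round (edges T) (run k S T t) (run k S T (Suc t))"
    if "length (run k S T t) = k" for t
  proof -
    have "legal_round (revealed T (history k S T t)) (run k S T t) (run k S T (Suc t))"
      using assms ne that by (simp add: exploration_strategy_def run_def)
    then show ?thesis
      unfolding legal_round_def by (rule list_all2_mono) (auto simp: revealed_def)
  qed
  have len: "length (run k S T t) = k" for t
  proof (induction t)
    case 0
    show ?case by (simp add: run_def)
  next
    case (Suc t)
    from step[OF this] this show ?case by (auto simp: legal_round_def dest: list_all2_lengthD)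
  qed
  show ?thesis
    using step len by (simp add: legal_schedule_def run_def)
qed

end

theory Submission
  imports Defs
begin

text \<open>
  Fix a constant \<open>h\<close> and let \<open>L\<close> be about \<open>max 1 D\<close>.  The adversary grows a \<open>d\<close>-ary tree whose
  edges are subdivided into paths of length \<open>L\<close>, with \<open>h * L * d ^ h\<close> of order \<open>n\<close>.  The frontier
  at stage \<open>i\<close>, i.e. at time \<open>i * h * L\<close>, is a set of about \<open>d ^ h\<close> unvisited leaves at depth
  \<open>(h + i) * L\<close>, all below one vertex \<open>u\<close> at depth \<open>i * L\<close>.  By averaging, one of the \<open>d\<close> branches at
  \<open>u\<close> contains many frontier leaves in comparison with its number of agents; each frontier leaf in
  this branch receives \<open>d\<close> new paths.  Agents outside the branch are more than \<open>h * L\<close> steps away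
  from the new leaves, and the (typically \<open>k / d\<close>) agents inside visit at most \<open>h * L\<close> new leaves
  each, which is negligible because \<open>d\<close> is a positive power of \<open>n\<close> while \<open>L\<close> is \<open>n\<close> to the \<open>o(1)\<close>.
  So after \<open>h\<close> stages, at time \<open>h\<^sup>2 * L\<close>, some vertex is still unvisited, although the height is
  about \<open>2 * h * L\<close> and the offline optimum is \<open>O(h * L)\<close>.  The ratio is of order \<open>h\<close>, which is
  arbitrary.
\<close>

subsection \<open>Trees of addresses\<close>

text \<open>Vertices are encoded lists: the parent of a nonempty list is its \<open>butlast\<close>, the depth of a
  list is its length.\<close>

definition list_adj :: "nat list \<Rightarrow> nat list \<Rightarrow> bool" where
  "list_adj x y \<longleftrightarrow> (x \<noteq> [] \<and> y = butlast x) \<or> (y \<noteq> [] \<and> x = butlast y)"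

definition list_tree :: "nat list set \<Rightarrow> rooted_graph" where
  "list_tree A = \<lparr>verts = to_nat ` A,
     edges = {(to_nat x, to_nat y) | x y. x \<in> A \<and> y \<in> A \<and> list_adj x y},
     root = to_nat ([] :: nat list)\<rparr>"

definition tree_set :: "nat list set \<Rightarrow> bool" where
  "tree_set A \<longleftrightarrow> finite A \<and> [] \<in> A \<and> (\<forall>x\<in>A. butlast x \<in> A)"

lemma list_tree_simps [simp]:
  "verts (list_tree A) = to_nat ` A"
  "root (list_tree A) = to_nat ([] :: nat list)"
  "(to_nat x, to_nat y) \<in> edges (list_tree A) \<longleftrightarrow> x \<in> A \<and> y \<in> A \<and> list_adj x y"
  by (auto simp: list_tree_def)

lemma edge_list_treeE:
  assumes "(u, v) \<in> edges (list_tree A)"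
  obtains x y where "u = to_nat x" "v = to_nat y" "x \<in> A" "y \<in> A" "list_adj x y"
  using assms by (auto simp: list_tree_def)

lemma list_adj_sym: "list_adj x y \<longleftrightarrow> list_adj y x"
  by (auto simp: list_adj_def)

lemma list_adj_irrefl [simp]: "\<not> list_adj x x"
  by (metis append_butlast_last_id append_self_conv list.distinct(1) list_adj_def)

lemma butlast_take_Suc: "m < length x \<Longrightarrow> butlast (take (Suc m) x) = take m x"
  by (simp add: butlast_take)

lemma list_adj_take_Suc: "m < length x \<Longrightarrow> list_adj (take (Suc m) x) (take m x)"
  unfolding list_adj_def by (auto simp: butlast_take_Suc)

lemma tree_set_take:
  assumes "tree_set A" "x \<in> A"
  shows "take m x \<in> A"
proof (cases "m \<le> length x")
  case True
  then show ?thesis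
  proof (induction rule: inc_induct)
    case base
    show ?case using assms by simp
  next
    case (step m)
    then have "butlast (take (Suc m) x) \<in> A"
      using assms by (auto simp: tree_set_def)
    then show ?case using step by (simp add: butlast_take_Suc)
  qed
qed (use assms in simp)

abbreviation prefixes_of :: "nat list set \<Rightarrow> nat list set" where
  "prefixes_of B \<equiv> (\<Union>x\<in>B. (\<lambda>m. take m x) ` {..length x})"

lemma tree_set_Un_prefixes:
  assumes "tree_set A" "finite B"
  shows "tree_set (A \<union> prefixes_of B)"
proof -
  have "butlast y \<in> (\<Union>x\<in>B. (\<lambda>m. take m x) ` {..length x})"
    if "x \<in> B" "m \<le> length x" "y = take m x" for x y m
  proof -
    have "butlast y = take (m - 1) x" "m - 1 \<le> length x"
      using that by (simp_all add: butlast_take)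
    then show ?thesis using that(1) by blast
  qed
  then show ?thesis
    using assms unfolding tree_set_def by auto
qed

text \<open>A single step appends or deletes one last letter, so from depth above \<open>r\<close>
  it cannot touch the first \<open>r\<close> letters: the agent stays below the same ancestor at
  depth \<open>r\<close>.\<close>

lemma list_adj_take:
  assumes "list_adj x y" "Suc r \<le> length x"
  shows "take r y = take r x"
proof -
  have "take r (butlast z) = take r z" if "Suc r \<le> length z" for z :: "nat list"
    using that by (simp add: butlast_conv_take min_absorb1)
  moreover have "Suc r \<le> length y" if "x = butlast y"
    using that assms by simp
  ultimately show ?thesis using assms unfolding list_adj_def by metis
qed

lemma list_adj_length: "list_adj x y \<Longrightarrow> length y \<le> Suc (length x)"
  unfolding list_adj_def by auto

lemma reachable_root:
  assumes "tree_set A" "x \<in> A"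
  shows "(to_nat ([] :: nat list), to_nat x) \<in> (edges (list_tree A))\<^sup>*"
proof -
  have "(to_nat ([] :: nat list), to_nat (take m x)) \<in> (edges (list_tree A))\<^sup>*" if "m \<le> length x" for m
    using that
  proof (induction m)
    case (Suc m)
    then have "(to_nat (take m x), to_nat (take (Suc m) x)) \<in> edges (list_tree A)"
      using assms by (simp add: tree_set_take list_adj_sym[of "take m x"] list_adj_take_Suc)
    with Suc show ?case by (meson Suc_leD rtrancl.rtrancl_into_rtrancl)
  qed simp
  from this[of "length x"] show ?thesis by simp
qed

lemma sym_list_tree: "sym (edges (list_tree A))"
  by (auto simp: sym_def list_tree_def list_adj_sym)

text \<open>At a deepest vertex of a cycle both cycle neighbours must be its parent, so they
  coincide, although the vertices of a cycle are distinct.\<close>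

lemma list_tree_acyclic: "\<not> is_cycle (edges (list_tree A)) p"
proof
  assume cyc: "is_cycle (edges (list_tree A)) p"
  define n where "n = length p"
  have n3: "n \<ge> 3" and dist: "distinct p" using cyc by (auto simp: is_cycle_def n_def)
  have nxt: "(p ! i, p ! ((i + 1) mod n)) \<in> edges (list_tree A)" if "i < n" for i
  proof (cases "i + 1 < n")
    case True
    then show ?thesis
      using cyc by (simp add: is_cycle_def n_def successively_conv_nth)
  next
    case False
    then have "i = n - 1" using that by simp
    moreover have "p \<noteq> []" using n3 by (auto simp: n_def)
    ultimately show ?thesis
      using cyc n3 by (simp add: is_cycle_def n_def last_conv_nth hd_conv_nth)
  qed
  define f where "f i = length (from_nat (p ! i) :: nat list)" for i
  obtain i where i: "i < n" "\<And>j. j < n \<Longrightarrow> f j \<le> f i"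
  proof -
    have fin: "finite (f ` {..<n})" by simp
    moreover have "f ` {..<n} \<noteq> {}" using n3 by (auto simp: lessThan_empty_iff)
    ultimately have "Max (f ` {..<n}) \<in> f ` {..<n}" by (rule Max_in)
    then obtain i where i: "i < n" "Max (f ` {..<n}) = f i" by auto
    have "f j \<le> f i" if "j < n" for j
      using Max_ge[OF fin, of "f j"] that i(2) by simp
    then show ?thesis using that i(1) by blast
  qed
  \<comment> \<open>No vertex of the cycle is deeper than \<open>p ! i\<close>, so a neighbour on
    the cycle cannot be a child and must be the parent.\<close>
  have up: "q = to_nat (butlast (from_nat (p ! i) :: nat list))"
    if "(p ! i, q) \<in> edges (list_tree A)" "q = p ! j" "j < n" for q j
    using that(1)
  proof (rule edge_list_treeE)
    fix x y
    assume xy: "p ! i = to_nat x" "q = to_nat y" "list_adj x y"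
    have "length y \<le> length x"
      using i(2)[OF that(3)] xy(1,2) by (simp add: f_def flip: that(2))
    then have "\<not> (y \<noteq> [] \<and> x = butlast y)" by (auto simp flip: length_greater_0_conv)
    then have "y = butlast x" using xy(3) unfolding list_adj_def by blast
    then show ?thesis using xy(1,2) by simp
  qed
  define j where "j = (i + n - 1) mod n"
  define l where "l = (i + 1) mod n"
  have jl: "j < n" "l < n" using n3 by (auto simp: j_def l_def)
  have "(j + 1) mod n = i"
  proof -
    have "(j + 1) mod n = (i + n - 1 + 1) mod n" unfolding j_def by (rule mod_add_left_eq)
    then show ?thesis using i n3 by simp
  qed
  then have "(p ! j, p ! i) \<in> edges (list_tree A)" using nxt[OF jl(1)] by simp
  then have "(p ! i, p ! j) \<in> edges (list_tree A)" using sym_list_tree by (auto dest: symD)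
  moreover have "(p ! i, p ! l) \<in> edges (list_tree A)" using nxt[OF i(1)] by (simp add: l_def)
  ultimately have "p ! j = p ! l"
    using up[OF _ refl jl(1)] up[OF _ refl jl(2)] by simp
  then have "j = l" using dist jl by (simp add: n_def nth_eq_iff_index_eq)
  \<comment> \<open>Resolving the cyclic indices shows that predecessor and successor of
    \<open>i\<close> differ as soon as \<open>n\<close> is at least 3.\<close>
  moreover have "j = (if i = 0 then n - 1 else i - 1)" "l = (if i + 1 = n then 0 else i + 1)"
    using i(1) n3 by (auto simp: j_def l_def le_mod_geq)
  ultimately show False using n3 i(1) by (simp split: if_splits)
qed

lemma rooted_tree_list_tree:
  assumes "tree_set A"
  shows "rooted_tree (list_tree A)"
proof -
  have "(u, v) \<in> (edges (list_tree A))\<^sup>*" if "u \<in> to_nat ` A" "v \<in> to_nat ` A" for u v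
    using that reachable_root[OF assms] sym_rtrancl[OF sym_list_tree, of A]
    by (auto dest: symD intro: rtrancl_trans)
  moreover have "irrefl (edges (list_tree A))"
    by (auto simp: irrefl_def elim!: edge_list_treeE)
  ultimately show ?thesis
    using assms sym_list_tree list_tree_acyclic
    unfolding rooted_tree_def by (auto simp: tree_set_def elim: edge_list_treeE)
qed

lemma card_verts_list_tree: "card (verts (list_tree A)) = card A"
  by (simp add: card_image)

text \<open>Each edge raises the depth by at most one; this turns depth into a lower bound for the
  distance from the root, hence for the height.\<close>

lemma walk_length:
  fixes x :: "nat list"
  assumes "(to_nat ([] :: nat list), to_nat x) \<in> edges (list_tree A) ^^ m"
  shows "length x \<le> m"
  using assms
proof (induction m arbitrary: x)
  case (Suc m)
  then obtain u where u: "(to_nat ([] :: nat list), u) \<in> edges (list_tree A) ^^ m"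
    "(u, to_nat x) \<in> edges (list_tree A)" by auto
  from u(2) obtain y where "u = to_nat (y :: nat list)" "list_adj y x"
    by (auto elim: edge_list_treeE)
  then show ?case using Suc.IH u(1) list_adj_length by fastforce
qed simp

lemma length_le_height:
  assumes "tree_set A" "x \<in> A"
  shows "length x \<le> height (list_tree A)"
proof -
  obtain m where "(to_nat ([] :: nat list), to_nat x) \<in> edges (list_tree A) ^^ m"
    using reachable_root[OF assms] by (auto simp: rtrancl_power)
  then have "length x \<le> distance (list_tree A) (root (list_tree A)) (to_nat x)"
    unfolding distance_def by (intro walk_length[where x = x and A = A]) (auto intro: LeastI)
  also have "\<dots> \<le> height (list_tree A)"
    unfolding height_def using assms by (intro Max_ge) (auto simp: tree_set_def)
  finally show ?thesis .
qed

subsection \<open>Schedules on trees of addresses\<close>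

lemma legal_schedule_length:
  assumes "legal_schedule k T X"
  shows "length (X t) = k"
proof (induction t)
  case (Suc t)
  have "legal_round (edges T) (X t) (X (Suc t))" using assms by (simp add: legal_schedule_def)
  with Suc show ?case by (auto simp: legal_round_def dest: list_all2_lengthD)
qed (use assms in \<open>simp add: legal_schedule_def\<close>)

lemma legal_schedule_step:
  assumes "legal_schedule k T X" "a < k"
  shows "X t ! a = X (Suc t) ! a \<or> (X t ! a, X (Suc t) ! a) \<in> edges T"
proof -
  have "legal_round (edges T) (X t) (X (Suc t))" using assms by (simp add: legal_schedule_def)
  then show ?thesis
    using assms legal_schedule_length[OF assms(1)] by (auto simp: legal_round_def list_all2_conv_all_nth)
qed

lemma legal_schedule_in_verts:
  assumes "legal_schedule k T X" "rooted_tree T"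
  shows "set (X t) \<subseteq> verts T"
proof -
  have "X t ! a \<in> verts T" if "a < k" for a
  proof (induction t)
    case 0
    then show ?case using assms that by (simp add: legal_schedule_def rooted_tree_def)
  next
    case (Suc t)
    with legal_schedule_step[OF assms(1) that, of t] assms(2) show ?case
      by (auto simp: rooted_tree_def)
  qed
  then show ?thesis
    using legal_schedule_length[OF assms(1)] by (auto simp: in_set_conv_nth)
qed

section \<open>Indistinguishable trees and confinement of agents\<close>

lemma set_history: "(\<Union>c\<in>set (history k S T t). set c) = (\<Union>s\<le>t. set (run k S T s))"
proof (induction t)
  case (Suc t)
  then show ?case by (simp add: run_def atMost_Suc Un_commute)
qed (simp add: run_def)

text \<open>Indistinguishability: if the extra vertices of \<open>B\<close> are attached only to
  vertices unvisited up to time \<open>t\<close>, the two trees reveal the same edges, and a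
  deterministic strategy makes the same moves on both. This lets the adversary decide the rest of
  the tree late.\<close>

lemma history_list_tree_cong:
  assumes strat: "exploration_strategy k S" and A: "tree_set A" and B: "tree_set B" and "A \<subseteq> B"
    and new: "\<And>x. x \<in> A \<Longrightarrow> to_nat x \<in> (\<Union>s\<le>t. set (run k S (list_tree A) s)) \<Longrightarrow>
      \<forall>y\<in>B. list_adj x y \<longrightarrow> y \<in> A"
    and "s \<le> t"
  shows "history k S (list_tree B) s = history k S (list_tree A) s"
  using \<open>s \<le> t\<close>
proof (induction s)
  case (Suc s)
  define h where "h = history k S (list_tree A) s"
  define V where "V = (\<Union>c\<in>set h. set c)"
  have V: "V \<subseteq> (\<Union>s\<le>t. set (run k S (list_tree A) s))"
    unfolding V_def h_def set_history using Suc.prems by (intro UN_mono) auto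
  have VA: "V \<subseteq> to_nat ` A"
    using V legal_schedule_in_verts[OF legal_schedule_run[OF strat] rooted_tree_list_tree[OF A]] by auto
  have V_edge: "y \<in> A" if "to_nat x \<in> V" "y \<in> B" "list_adj x y" for x y
  proof -
    have "x \<in> A" using that(1) VA by (auto dest: injD[OF inj_to_nat])
    moreover have "to_nat x \<in> (\<Union>s\<le>t. set (run k S (list_tree A) s))" using that(1) V by blast
    ultimately show ?thesis using new that by blast
  qed
  \<comment> \<open>What is revealed depends on the past only through the set \<open>V\<close> of
    visited vertices.\<close>
  have rev: "revealed T h = {(u, v) \<in> edges T. u \<in> V \<or> v \<in> V}" for T
    by (auto simp: revealed_def V_def)
  have "revealed (list_tree B) h = revealed (list_tree A) h"
  proof -
    have "(u, v) \<in> edges (list_tree B) \<longleftrightarrow> (u, v) \<in> edges (list_tree A)" if "u \<in> V \<or> v \<in> V" for u v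
    proof
      assume "(u, v) \<in> edges (list_tree B)"
      then obtain x y where "u = to_nat x" "v = to_nat y" "x \<in> B" "y \<in> B" "list_adj x y"
        by (rule edge_list_treeE)
      then show "(u, v) \<in> edges (list_tree A)"
        using that V_edge[of x y] V_edge[of y x] VA list_adj_sym[of x y] by auto
    qed (use \<open>A \<subseteq> B\<close> in \<open>auto elim!: edge_list_treeE\<close>)
    then show ?thesis unfolding rev by auto
  qed
  with Suc show ?case by (simp add: h_def)
qed simp

text \<open>Going backwards in time from \<open>y\<close>, the depth drops by at most one per round
  and stays at least \<open>r\<close>, so the ancestor at depth \<open>r\<close> was the same all
  along. An agent reaching a deep vertex was therefore already in its branch \<open>m\<close> rounds
  earlier.\<close>

lemma schedule_take:
  assumes "legal_schedule k (list_tree A) X" "a < k"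
    and "X t ! a = to_nat (x :: nat list)" "X (t + m) ! a = to_nat (y :: nat list)" "r + m \<le> length y"
  shows "take r x = take r y"
  using assms(4,5)
proof (induction m arbitrary: y r)
  case 0
  then show ?case using assms(3) by simp
next
  case (Suc m)
  have "X (t + m) ! a = X (Suc (t + m)) ! a \<or> (X (t + m) ! a, X (Suc (t + m)) ! a) \<in> edges (list_tree A)"
    using legal_schedule_step[OF assms(1,2)] .
  then show ?case
  proof
    assume "X (t + m) ! a = X (Suc (t + m)) ! a"
    then show ?case using Suc by auto
  next
    assume "(X (t + m) ! a, X (Suc (t + m)) ! a) \<in> edges (list_tree A)"
    then obtain z where z: "X (t + m) ! a = to_nat (z :: nat list)" "list_adj z y"
      using Suc.prems by (auto elim!: edge_list_treeE)
    then have zy: "list_adj y z" using list_adj_sym by blast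
    have "length y \<le> Suc (length z)" using z(2) list_adj_length by blast
    then have "take r x = take r z" using Suc.IH[OF z(1)] Suc.prems(2) by simp
    also have "\<dots> = take r y" using list_adj_take[OF zy] Suc.prems(2) by simp
    finally show ?case .
  qed
qed

subsection \<open>The adversary\<close>

text \<open>A word names a vertex of a \<open>d\<close>-ary tree; repeating each letter
  \<open>L\<close> times gives its address after every edge has been subdivided into a path of
  length \<open>L\<close>.\<close>

definition stretch :: "nat \<Rightarrow> nat list \<Rightarrow> nat list" where
  "stretch L w = concat (map (replicate L) w)"

lemma stretch_simps [simp]:
  "stretch L [] = []" "stretch L (a # w) = replicate L a @ stretch L w"
  "stretch L (v @ w) = stretch L v @ stretch L w"
  by (simp_all add: stretch_def)

lemma length_stretch [simp]: "length (stretch L w) = L * length w"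
  by (induction w) simp_all

lemma take_stretch: "take (L * m) (stretch L w) = stretch L (take m w)"
proof (induction w arbitrary: m)
  case (Cons a w)
  then show ?case by (cases m) simp_all
qed simp

lemma inj_stretch:
  assumes "L > 0"
  shows "inj (stretch L)"
proof (rule injI)
  fix v w
  assume "stretch L v = stretch L w"
  then show "v = w"
  proof (induction v arbitrary: w)
    case Nil
    then have "length (stretch L w) = 0" by (metis length_0_conv stretch_simps(1))
    then show ?case using assms by simp
  next
    case (Cons a v)
    then have "L * length w = L * Suc (length v)" by (metis length_stretch length_Cons)
    then obtain b u where "w = b # u" using assms by (cases w) auto
    then show ?case using Cons assms by (auto simp: append_eq_append_conv replicate_eq_replicate)
  qed
qed

text \<open>The prefixes of length at most \<open>r\<close> are already in \<open>A\<close>, so each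
  element of \<open>B\<close> contributes at most its \<open>l\<close> longer prefixes.\<close>

lemma card_Un_prefixes_le:
  assumes "finite A" "finite B"
    and "\<And>x. x \<in> B \<Longrightarrow> length x = r + l"
    and "\<And>x m. x \<in> B \<Longrightarrow> m \<le> r \<Longrightarrow> take m x \<in> A"
  shows "card (A \<union> prefixes_of B) \<le> card A + l * card B"
proof -
  have "A \<union> prefixes_of B \<subseteq> A \<union> (\<lambda>(x, m). take m x) ` (B \<times> {r<..r + l})"
  proof
    fix y assume "y \<in> A \<union> prefixes_of B"
    then consider "y \<in> A" | x m where "x \<in> B" "m \<le> length x" "y = take m x" by auto
    then show "y \<in> A \<union> (\<lambda>(x, m). take m x) ` (B \<times> {r<..r + l})"
    proof cases
      case 2
      then show ?thesis using assms(3)[of x] assms(4)[of x m] by (cases "m \<le> r") force+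
    qed simp
  qed
  then have "card (A \<union> prefixes_of B) \<le> card (A \<union> (\<lambda>(x, m). take m x) ` (B \<times> {r<..r + l}))"
    using assms by (intro card_mono) auto
  also have "\<dots> \<le> card A + card ((\<lambda>(x, m). take m x) ` (B \<times> {r<..r + l}))"
    by (rule card_Un_le)
  also have "card ((\<lambda>(x, m). take m x) ` (B \<times> {r<..r + l})) \<le> card (B \<times> {r<..r + l})"
    using assms by (intro card_image_le) auto
  finally show ?thesis by (simp add: card_cartesian_product mult.commute)
qed

text \<open>Branch \<open>j\<close> holds \<open>w j\<close> frontier leaves and \<open>a j\<close> agents, each of which can visit \<open>q\<close> of the
  \<open>d * w j\<close> new leaves.  So \<open>d * w j - q * a j\<close> of them survive, on average \<open>N - q * k / d\<close>; the
  statement is free of subtraction and division.\<close>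

lemma averaging:
  fixes w a :: "nat \<Rightarrow> nat"
  assumes "d > 0" "sum w {..<d} = N" "sum a {..<d} \<le> k"
  shows "\<exists>j<d. d * N + d * (q * a j) \<le> d * (d * w j) + q * k"
proof (rule ccontr)
  assume "\<not> ?thesis"
  then have "(\<Sum>j<d. d * (d * w j) + q * k) < (\<Sum>j<d. d * N + d * (q * a j))"
    using assms(1) by (intro sum_strict_mono) (auto simp: not_le lessThan_empty_iff)
  also have "\<dots> = d * (d * N) + d * (q * sum a {..<d})"
    by (simp add: sum.distrib sum_distrib_left)
  also have "\<dots> \<le> d * (d * N) + d * (q * k)" using assms(3) by simp
  also have "\<dots> = (\<Sum>j<d. d * (d * w j) + q * k)"
    by (simp add: sum.distrib sum_distrib_left assms(2)[symmetric])
  finally show False by simp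
qed

section \<open>The invariant of the adversary and its induction\<close>

definition visited :: "nat \<Rightarrow> strategy \<Rightarrow> nat list set \<Rightarrow> nat \<Rightarrow> nat set" where
  "visited k S A t = (\<Union>s\<le>t. set (run k S (list_tree A) s))"

text \<open>\<open>A\<close> is the tree known at time \<open>i * h * L\<close>, the words in \<open>W\<close> describe the unvisited leaves, and
  \<open>p\<close> describes their common ancestor \<open>u\<close>.  The last conjunct says that every stage costs at most
  \<open>h * L * k / d\<close> of the \<open>d ^ h\<close> leaves.\<close>

definition stage ::
  "nat \<Rightarrow> strategy \<Rightarrow> nat \<Rightarrow> nat \<Rightarrow> nat \<Rightarrow> nat \<Rightarrow> nat list set \<Rightarrow> nat list set \<Rightarrow> nat list \<Rightarrow> bool"
  where
  "stage k S h L d i A W p \<longleftrightarrow>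
     tree_set A \<and> (\<forall>x\<in>A. length x \<le> L * (h + i)) \<and> card A \<le> 1 + L * (h + i) * d ^ h \<and>
     length p = i \<and>
     (\<forall>w\<in>W. length w = h + i \<and> set w \<subseteq> {..<d} \<and> take i w = p \<and> stretch L w \<in> A \<and>
        to_nat (stretch L w) \<notin> visited k S A (i * (h * L))) \<and>
     d ^ (h + 1) \<le> d * card W + i * (h * L * k)"

text \<open>The start is the full subdivided \<open>d\<close>-ary tree of \<open>h\<close> levels,
  with all \<open>d ^ h\<close> leaves as frontier; at time 0 only the root is visited, and the
  leaves lie strictly below it.\<close>

lemma stage_0:
  assumes "h > 0" "L > 0"
  shows "\<exists>A W p. stage k S h L d 0 A W p"
proof -
  define W where "W = {w :: nat list. set w \<subseteq> {..<d} \<and> length w = h}"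
  have W: "finite W" "card W = d ^ h"
    using finite_lists_length_eq[of "{..<d}" h] card_lists_length_eq[of "{..<d}" h]
    by (auto simp: W_def)
  define A where "A = {[]} \<union> prefixes_of (stretch L ` W)"
  have "tree_set A" unfolding A_def
    using W by (intro tree_set_Un_prefixes) (auto simp: tree_set_def)
  moreover have "card A \<le> 1 + L * h * d ^ h"
  proof -
    have "card A \<le> card {[] :: nat list} + (L * h) * card (stretch L ` W)"
      unfolding A_def using W by (intro card_Un_prefixes_le[where r = 0]) (auto simp: W_def)
    also have "card (stretch L ` W) \<le> d ^ h" using W card_image_le by metis
    finally show ?thesis by simp
  qed
  moreover have "length x \<le> L * h" if "x \<in> A" for x
    using that by (auto simp: A_def W_def)
  moreover have "stretch L w \<in> A" if "w \<in> W" for w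
    using that unfolding A_def by (intro UnI2 UN_I[of "stretch L w"] image_eqI[of _ _ "length (stretch L w)"]) auto
  moreover have "to_nat (stretch L w) \<notin> visited k S A 0" if "w \<in> W" for w
  proof -
    have "length (stretch L w) > 0" using that assms by (simp add: W_def)
    then have "stretch L w \<noteq> []" by fastforce
    then show ?thesis by (auto simp: visited_def run_def)
  qed
  ultimately have "stage k S h L d 0 A W []"
    using W by (auto simp: stage_def W_def)
  then show ?thesis by blast
qed

lemma run_eq_if_history_eq:
  "history k S T s = history k S T' s \<Longrightarrow> run k S T s = run k S T' s"
  by (simp add: run_def)

lemma run_nth_in:
  assumes "exploration_strategy k S" "tree_set A" "a < k"
  obtains x where "x \<in> A" "run k S (list_tree A) t ! a = to_nat x"
proof -
  have "length (run k S (list_tree A) t) = k"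
    using legal_schedule_length[OF legal_schedule_run[OF assms(1)]] .
  then have "run k S (list_tree A) t ! a \<in> to_nat ` A"
    using legal_schedule_in_verts[OF legal_schedule_run[OF assms(1)] rooted_tree_list_tree[OF assms(2)], of t] assms(3)
    by (auto dest: nth_mem)
  then show ?thesis using that by blast
qed

text \<open>One branch \<open>j\<close> is chosen by averaging and its frontier leaves are extended.
  The old run stays valid up to \<open>t0\<close> because these leaves are unvisited, and up to
  \<open>t1\<close> only agents already in the branch can reach the new leaves.\<close>

lemma stage_Suc:
  assumes strat: "exploration_strategy k S" and pos: "h > 0" "L > 0" "d > 0"
    and st: "stage k S h L d i A W p"
  shows "\<exists>A W p. stage k S h L d (Suc i) A W p"
proof -
  define t0 where "t0 = i * (h * L)"
  define t1 where "t1 = t0 + h * L"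
  have A: "tree_set A" "\<And>x. x \<in> A \<Longrightarrow> length x \<le> L * (h + i)" "card A \<le> 1 + L * (h + i) * d ^ h"
    and p: "length p = i"
    and W: "\<And>w. w \<in> W \<Longrightarrow> length w = h + i \<and> set w \<subseteq> {..<d} \<and> take i w = p \<and> stretch L w \<in> A"
    and unvis: "\<And>w. w \<in> W \<Longrightarrow> to_nat (stretch L w) \<notin> visited k S A t0"
    and cW: "d ^ (h + 1) \<le> d * card W + i * (h * L * k)"
    using st by (auto simp: stage_def t0_def)
  have finW: "finite W"
    by (rule finite_subset[OF _ finite_lists_length_eq[of "{..<d}" "h + i"]]) (use W in auto)
  \<comment> \<open>\<open>loc\<close> records positions at time \<open>t0\<close>;
    \<open>G j\<close> and \<open>V j\<close> are the agents and the frontier words in the branch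
    that continues \<open>p\<close> by the letter \<open>j\<close>.\<close>
  define loc where "loc a = (from_nat (run k S (list_tree A) t0 ! a) :: nat list)" for a
  define G where "G j = {a. a < k \<and> take (L * Suc i) (loc a) = stretch L (p @ [j])}" for j
  define V where "V j = {w \<in> W. w ! i = j}" for j
  have finV: "finite (V j)" for j using finW by (simp add: V_def)
  have "w ! i < d" if "w \<in> W" for w
    using W[OF that] pos(1) nth_mem[of i w] by (auto simp del: nth_mem)
  then have UV: "(\<Union>j<d. V j) = W"
    unfolding V_def by blast
  have "card (\<Union>j<d. V j) = (\<Sum>j<d. card (V j))"
    using finV by (intro card_UN_disjoint) (auto simp: V_def)
  then have sumV: "(\<Sum>j<d. card (V j)) = card W"
    unfolding UV by (rule sym)
  have finG: "finite (G j)" for j by (simp add: G_def)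
  have "j = j'" if "a \<in> G j" "a \<in> G j'" for a j j'
  proof -
    have "stretch L (p @ [j]) = stretch L (p @ [j'])" using that by (simp add: G_def)
    then have "p @ [j] = p @ [j']" using inj_stretch[OF pos(2)] by (blast dest: injD)
    then show ?thesis by simp
  qed
  then have "(\<Sum>j<d. card (G j)) = card (\<Union>j<d. G j)"
    using finG by (intro card_UN_disjoint[symmetric]) auto
  also have "\<dots> \<le> card {..<k}" by (intro card_mono) (auto simp: G_def)
  finally have sumG: "(\<Sum>j<d. card (G j)) \<le> k" by simp
  \<comment> \<open>The quota \<open>q\<close> is \<open>h * L\<close>, the number of rounds in one
    stage, since an agent visits at most one vertex per round.\<close>
  obtain j where j: "j < d"
    and avg: "d * card W + d * (h * L * card (G j)) \<le> d * (d * card (V j)) + h * L * k"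
    using averaging[OF pos(3) sumV sumG, of "h * L"] by blast
  define C where "C = (\<lambda>(w, c). w @ [c]) ` (V j \<times> {..<d})"
  have cC: "card C = d * card (V j)"
    unfolding C_def by (subst card_image) (auto simp: inj_on_def card_cartesian_product)
  have finC: "finite C" using finV by (simp add: C_def)
  have C: "length v = h + Suc i \<and> set v \<subseteq> {..<d} \<and> take (Suc i) v = p @ [j]
      \<and> take (L * (h + i)) (stretch L v) = stretch L (butlast v) \<and> butlast v \<in> W"
    if "v \<in> C" for v
  proof -
    obtain w c where w: "v = w @ [c]" "w \<in> V j" "c < d" using \<open>v \<in> C\<close> by (auto simp: C_def)
    then have "w \<in> W" by (simp add: V_def)
    have "take (Suc i) w = take i w @ [w ! i]"
      using W[OF \<open>w \<in> W\<close>] pos by (intro take_Suc_conv_app_nth) simp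
    then show ?thesis
      using W[OF \<open>w \<in> W\<close>] pos w by (auto simp: V_def take_stretch)
  qed
  define A' where "A' = A \<union> prefixes_of (stretch L ` C)"
  have A': "tree_set A'"
    unfolding A'_def using finC A by (intro tree_set_Un_prefixes) auto
  have old: "take m (stretch L v) \<in> A" if "v \<in> C" "m \<le> L * (h + i)" for v m
  proof -
    have "take m (stretch L v) = take m (take (L * (h + i)) (stretch L v))"
      using that by (simp add: min_def)
    also have "\<dots> \<in> A" using C[OF that(1)] W A(1) by (simp add: tree_set_take)
    finally show ?thesis .
  qed
  \<comment> \<open>Words in \<open>V j\<close> share their first \<open>i + 1\<close> letters,
    leaving \<open>h - 1\<close> free ones. Thus multiplying by \<open>d\<close> brings the frontier
    back to at most \<open>d ^ h\<close>, and each stage adds at most \<open>L * d ^ h\<close>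
    vertices.\<close>
  have "card (V j) \<le> d ^ (h - 1)"
  proof -
    have "inj_on (drop (Suc i)) (V j)"
    proof (rule inj_onI)
      fix v w assume vw: "v \<in> V j" "w \<in> V j" "drop (Suc i) v = drop (Suc i) w"
      have "take (Suc i) u = p @ [j]" if "u \<in> V j" for u
        using W[of u] that pos by (auto simp: V_def take_Suc_conv_app_nth)
      then show "v = w" using vw by (metis append_take_drop_id)
    qed
    moreover have "drop (Suc i) ` V j \<subseteq> {w. set w \<subseteq> {..<d} \<and> length w = h - 1}"
      using W by (auto simp: V_def dest!: in_set_dropD)
    ultimately have "card (V j) \<le> card {w. set w \<subseteq> {..<d} \<and> length w = h - 1}"
      by (metis card_image card_mono finite_lessThan finite_lists_length_eq)
    then show ?thesis by (simp add: card_lists_length_eq)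
  qed
  then have "card C \<le> d * d ^ (h - 1)" using cC by simp
  also have "\<dots> = d ^ h" using pos by (cases h) auto
  finally have "card C \<le> d ^ h" .
  then have cSC: "card (stretch L ` C) \<le> d ^ h"
    using card_image_le[OF finC] le_trans by blast
  have "card A' \<le> card A + L * card (stretch L ` C)"
    unfolding A'_def
    by (rule card_Un_prefixes_le[where r = "L * (h + i)"])
      (use finC A old C in \<open>auto simp: tree_set_def algebra_simps\<close>)
  also have "\<dots> \<le> 1 + L * (h + i) * d ^ h + L * d ^ h"
    using A(3) cSC by (intro add_mono mult_left_mono) auto
  finally have cA': "card A' \<le> 1 + L * (h + Suc i) * d ^ h" by (simp add: algebra_simps)
  have lenA': "length x \<le> L * (h + Suc i)" if "x \<in> A'" for x
  proof -
    from that consider "x \<in> A" | v m where "v \<in> C" "x = take m (stretch L v)"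
      by (auto simp: A'_def)
    then show ?thesis
    proof cases
      case 1
      then show ?thesis using A(2)[of x] by (simp add: algebra_simps)
    next
      case 2
      then show ?thesis using C[of v] by simp
    qed
  qed
  have hist: "run k S (list_tree A') s = run k S (list_tree A) s" if "s \<le> t0" for s
  proof (rule run_eq_if_history_eq, rule history_list_tree_cong[OF strat A(1) A' _ _ that])
    show "A \<subseteq> A'" by (simp add: A'_def)
    show "\<forall>y\<in>A'. list_adj x y \<longrightarrow> y \<in> A"
      if x: "x \<in> A" "to_nat x \<in> (\<Union>s\<le>t0. set (run k S (list_tree A) s))" for x
    proof (intro ballI impI)
      fix y assume y: "y \<in> A'" "list_adj x y"
      show "y \<in> A"
      proof (rule ccontr)
        assume "y \<notin> A"
        then obtain v m where v: "v \<in> C" "m \<le> L * (h + Suc i)" "y = take m (stretch L v)"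
          using y(1) C by (fastforce simp: A'_def)
        then have m: "m > L * (h + i)" using old[of v m] \<open>y \<notin> A\<close> by (meson not_le)
        have ly: "length y = m" using v C[OF v(1)] by simp
        have lx: "length x \<le> L * (h + i)" using A(2) x(1) by blast
        \<comment> \<open>\<open>y\<close> is deeper than all of \<open>A\<close>, so it is a child
          of \<open>x\<close> and lies just one level below the frontier. Hence \<open>x\<close> is
          the frontier leaf at which the new path starts, and that leaf is unvisited.\<close>
        have "x = butlast y" using y(2) m ly lx by (auto simp: list_adj_def)
        moreover have "m = Suc (L * (h + i))"
          using list_adj_length[OF y(2)] ly lx m by simp
        ultimately have "x = take (L * (h + i)) (stretch L v)"
          using v C[OF v(1)] by (simp add: butlast_take)
        then have "x = stretch L (butlast v)" "butlast v \<in> W" using C[OF v(1)] by auto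
        then show False using unvis x(2) by (auto simp: visited_def)
      qed
    qed
  qed
  define W' where "W' = {v \<in> C. to_nat (stretch L v) \<notin> visited k S A' t1}"
  have sched: "legal_schedule k (list_tree A') (run k S (list_tree A'))"
    by (rule legal_schedule_run[OF strat])
  \<comment> \<open>Each new leaf lost by time \<open>t1\<close> is charged to an agent of the
    branch and a round of this stage.\<close>
  have "(\<lambda>v. to_nat (stretch L v)) ` (C - W') \<subseteq>
      (\<lambda>(a, s). run k S (list_tree A') s ! a) ` (G j \<times> {t0<..t1})"
  proof
    fix u assume "u \<in> (\<lambda>v. to_nat (stretch L v)) ` (C - W')"
    then obtain v where v: "v \<in> C" "u = to_nat (stretch L v)" "u \<in> visited k S A' t1"
      by (auto simp: W'_def)
    then obtain s where s: "s \<le> t1" "u \<in> set (run k S (list_tree A') s)"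
      by (auto simp: visited_def)
    then obtain a where a: "a < k" "run k S (list_tree A') s ! a = u"
      using legal_schedule_length[OF sched] by (metis in_set_conv_nth)
    have lv: "length (stretch L v) = L * (h + Suc i)" using C[OF v(1)] by simp
    \<comment> \<open>Up to \<open>t0\<close> the agents move as in \<open>A\<close>, which has no
      vertex of this depth.\<close>
    have "s > t0"
    proof (rule ccontr)
      assume "\<not> s > t0"
      then have "run k S (list_tree A) s ! a = u" using a hist by simp
      then have "stretch L v \<in> A" using run_nth_in[OF strat A(1) a(1), of s] v(2)
        by (metis from_nat_to_nat)
      from A(2)[OF this] have "L * (h + Suc i) \<le> L * (h + i)" unfolding lv .
      then show False using pos by simp
    qed
    \<comment> \<open>The leaf has depth \<open>L * Suc i + h * L\<close>, and at most
      \<open>h * L\<close> rounds have passed since \<open>t0\<close>, so the agent was already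
      below the branch vertex at depth \<open>L * Suc i\<close>.\<close>
    have "take (L * Suc i) (loc a) = take (L * Suc i) (stretch L v)"
    proof (rule schedule_take[OF sched a(1), of t0 _ "s - t0"])
      show "run k S (list_tree A') t0 ! a = to_nat (loc a)"
        using run_nth_in[OF strat A(1) a(1), of t0] hist[of t0]
        by (metis loc_def from_nat_to_nat order_refl)
      show "run k S (list_tree A') (t0 + (s - t0)) ! a = to_nat (stretch L v)"
        using a v \<open>s > t0\<close> by simp
      show "L * Suc i + (s - t0) \<le> length (stretch L v)"
        using s(1) lv by (simp add: t1_def algebra_simps)
    qed
    also have "\<dots> = stretch L (p @ [j])" using C[OF v(1)] by (simp only: take_stretch)
    finally have "a \<in> G j" using a by (simp add: G_def)
    then show "u \<in> (\<lambda>(a, s). run k S (list_tree A') s ! a) ` (G j \<times> {t0<..t1})"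
      using a s \<open>s > t0\<close> by (auto intro!: image_eqI[of _ _ "(a, s)"])
  qed
  then have "card ((\<lambda>v. to_nat (stretch L v)) ` (C - W')) \<le>
      card ((\<lambda>(a, s). run k S (list_tree A') s ! a) ` (G j \<times> {t0<..t1}))"
    using finG by (intro card_mono) auto
  also have "\<dots> \<le> card (G j \<times> {t0<..t1})" using finG by (intro card_image_le) auto
  also have "card ((\<lambda>v. to_nat (stretch L v)) ` (C - W')) = card (C - W')"
    using inj_stretch[OF pos(2)] by (intro card_image) (auto simp: inj_on_def dest: injD)
  finally have "card (C - W') \<le> h * L * card (G j)"
    by (simp add: card_cartesian_product t1_def mult.commute)
  moreover have "card C = card W' + card (C - W')"
    using finC card_Diff_subset[of W' C] card_mono[of C W']
    by (simp add: W'_def finite_subset)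
  ultimately have "d * (d * card (V j)) \<le> d * card W' + d * (h * L * card (G j))"
    using cC by (metis add_left_mono distrib_left mult_le_mono2)
  \<comment> \<open>Adding the three estimates cancels the losses
    \<open>d * (h * L * card (G j))\<close>, and the stage costs only a further
    \<open>h * L * k\<close>.\<close>
  then have cW': "d ^ (h + 1) \<le> d * card W' + Suc i * (h * L * k)"
    using avg cW by simp
  have "stretch L v \<in> A'" if "v \<in> C" for v
    using that unfolding A'_def
    by (intro UnI2 UN_I[of "stretch L v"] image_eqI[of _ _ "length (stretch L v)"]) auto
  moreover have "t1 = Suc i * (h * L)" by (simp add: t1_def t0_def)
  ultimately have "stage k S h L d (Suc i) A' W' (p @ [j])"
    using A' cA' lenA' C p cW' unfolding stage_def W'_def by auto
  then show ?thesis by blast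
qed

lemma stage_exists:
  assumes "exploration_strategy k S" "h > 0" "L > 0" "d > 0"
  shows "\<exists>A W p. stage k S h L d i A W p"
proof (induction i)
  case 0
  show ?case using assms stage_0 by blast
next
  case (Suc i)
  then show ?case using stage_Suc[OF assms] by blast
qed

text \<open>After \<open>h\<close> stages some leaf \<open>z\<close> is still unvisited. The missing
  vertices are hung on \<open>z\<close> as leaves, giving exactly \<open>n\<close> vertices without
  being noticed before time \<open>h * h * L\<close>.\<close>

lemma hard_tree:
  assumes strat: "exploration_strategy k S" and pos: "h > 0" "L > 0" "d > 0"
    and few: "h * h * L * k < d ^ (h + 1)" and n: "1 + 2 * h * L * d ^ h \<le> n"
  obtains B where "tree_set B" "card B = n" "\<And>x. x \<in> B \<Longrightarrow> length x \<le> 2 * h * L + 1"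
    "\<exists>x\<in>B. length x \<ge> L" "enat (h * h * L) \<le> exploration_time (list_tree B) (run k S (list_tree B))"
proof -
  obtain A W p where st: "stage k S h L d h A W p"
    using stage_exists[OF strat pos] by blast
  have A: "tree_set A" "\<And>x. x \<in> A \<Longrightarrow> length x \<le> 2 * h * L" "card A \<le> n"
    and W: "\<And>w. w \<in> W \<Longrightarrow> length w = 2 * h \<and> stretch L w \<in> A \<and>
      to_nat (stretch L w) \<notin> visited k S A (h * h * L)"
    and cW: "d ^ (h + 1) \<le> d * card W + h * h * L * k"
    using st n by (force simp: stage_def algebra_simps)+
  \<comment> \<open>With an empty frontier the invariant would contradict
    \<open>few\<close>.\<close>
  have "W \<noteq> {}" using cW few by auto
  then obtain w where w: "w \<in> W" by blast
  define z where "z = stretch L w"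
  have z: "z \<in> A" "length z = 2 * h * L" "to_nat z \<notin> visited k S A (h * h * L)"
    using W[OF w] by (simp_all add: z_def)
  define N where "N = (\<lambda>j. z @ [j]) ` {..<n - card A}"
  define B where "B = A \<union> N"
  have N: "length y = 2 * h * L + 1" "butlast y = z" if "y \<in> N" for y
    using that z by (auto simp: N_def)
  have "card N = n - card A" unfolding N_def by (subst card_image) (auto simp: inj_on_def)
  moreover have "A \<inter> N = {}" using A(2) N(1) by fastforce
  ultimately have cB: "card B = n"
    using A(1,3) unfolding B_def
    by (subst card_Un_disjoint) (auto simp: tree_set_def N_def)
  have B: "tree_set B" using A(1) N z by (auto simp: tree_set_def B_def N_def)
  have run: "run k S (list_tree B) s = run k S (list_tree A) s" if "s \<le> h * h * L" for s
  proof (rule run_eq_if_history_eq, rule history_list_tree_cong[OF strat A(1) B _ _ that])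
    show "A \<subseteq> B" by (simp add: B_def)
    show "\<forall>y\<in>B. list_adj x y \<longrightarrow> y \<in> A"
      if x: "x \<in> A" "to_nat x \<in> (\<Union>s\<le>h * h * L. set (run k S (list_tree A) s))" for x
    proof (intro ballI impI)
      fix y assume y: "y \<in> B" "list_adj x y"
      have "x \<noteq> z" using x(2) z(3) by (auto simp: visited_def)
      moreover have "length x \<le> 2 * h * L" using A(2) x(1) by blast
      ultimately have "y \<notin> N" using y(2) N[of y] by (auto simp: list_adj_def)
      then show "y \<in> A" using y(1) by (simp add: B_def)
    qed
  qed
  have "enat (h * h * L) \<le> exploration_time (list_tree B) (run k S (list_tree B))"
    unfolding exploration_time_def
  proof (rule Inf_greatest)
    fix e assume "e \<in> {enat t |t. verts (list_tree B) \<subseteq> (\<Union>s\<le>t. set (run k S (list_tree B) s))}"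
    then obtain t where t: "e = enat t" "to_nat ` B \<subseteq> (\<Union>s\<le>t. set (run k S (list_tree B) s))"
      by auto
    show "enat (h * h * L) \<le> e"
    proof (rule ccontr)
      assume "\<not> enat (h * h * L) \<le> e"
      then have "t < h * h * L" using t(1) by simp
      moreover obtain s where "s \<le> t" "to_nat z \<in> set (run k S (list_tree B) s)"
        using t(2) z(1) by (auto simp: B_def)
      ultimately have "to_nat z \<in> visited k S A (h * h * L)"
        using run[of s] by (auto simp: visited_def intro!: bexI[of _ s])
      then show False using z(3) by simp
    qed
  qed
  moreover have "\<exists>x\<in>B. length x \<ge> L"
    using z pos by (intro bexI[of _ z]) (auto simp: B_def)
  moreover have "length x \<le> 2 * h * L + 1" if "x \<in> B" for x
    using that A(2)[of x] N(1)[of x] by (auto simp: B_def)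
  ultimately show ?thesis using that B cB by blast
qed

subsection \<open>The offline optimum and the ratio\<close>

lemma list_adj_take_pred: "take m x = take (Suc m) x \<or> list_adj (take m x) (take (Suc m) x)"
  using list_adj_take_Suc[of m x] list_adj_sym by (cases "m < length x") auto

lemma offline_optimum_le:
  assumes A: "tree_set A" and H: "\<And>x. x \<in> A \<Longrightarrow> length x \<le> H" "H > 0" and k: "card A \<le> K * k"
  shows "offline_optimum k (list_tree A) \<le> enat (2 * H * K)"
proof -
  have finA: "finite A" "[] \<in> A" using A by (auto simp: tree_set_def)
  then have "card A > 0" by (auto simp: card_gt_0_iff)
  then have "k > 0" using k by (cases k) auto
  obtain e where e: "bij_betw e {0..<card A} A" using ex_bij_betw_nat_finite[OF finA(1)] by blast
  \<comment> \<open>Indices beyond the last vertex get the root, so surplus agents just wait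
    there.\<close>
  define g where "g m = (if m < card A then e m else [])" for m
  have g: "g m \<in> A" for m using e finA by (auto simp: g_def bij_betw_def)
  \<comment> \<open>In each of \<open>K\<close> periods of length \<open>2 * H\<close>, every agent walks to one assigned vertex and back.\<close>
  define f where "f a t = take (min (t mod (2 * H)) (2 * H - t mod (2 * H))) (g (a + k * (t div (2 * H))))" for a t
  define X where "X t = map (\<lambda>a. to_nat (f a t)) [0..<k]" for t
  have fA: "f a t \<in> A" for a t unfolding f_def by (rule tree_set_take[OF A g])
  have step: "f a t = f a (Suc t) \<or> list_adj (f a t) (f a (Suc t))" for a t
  \<comment> \<open>The last round of a period leads back to the root, where the assigned vertex may
    change.\<close>
  proof (cases "Suc (t mod (2 * H)) = 2 * H")
    case True
    then have "f a (Suc t) = []" by (simp add: f_def mod_Suc)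
    moreover have "f a t = take (Suc 0) (g (a + k * (t div (2 * H))))"
    proof -
      have "min (t mod (2 * H)) (2 * H - t mod (2 * H)) = Suc 0" using True H(2) by linarith
      then show ?thesis by (simp add: f_def)
    qed
    ultimately show ?thesis
      using list_adj_take_pred[of 0 "g (a + k * (t div (2 * H)))"] list_adj_sym by auto
  next
    case False
    define r where "r = t mod (2 * H)"
    define x where "x = g (a + k * (t div (2 * H)))"
    have "r < 2 * H" unfolding r_def using H(2) by (intro mod_less_divisor) simp
    then have r: "Suc r < 2 * H" using False by (simp add: r_def)
    have ft: "f a t = take (min r (2 * H - r)) x" by (simp add: f_def r_def x_def)
    have fS: "f a (Suc t) = take (min (Suc r) (2 * H - Suc r)) x"
      using False by (simp add: f_def r_def x_def mod_Suc div_Suc)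
    show ?thesis
    proof (cases "r < H")
      case True
      then have "min r (2 * H - r) = r" "min (Suc r) (2 * H - Suc r) = Suc r" by auto
      then show ?thesis using ft fS list_adj_take_pred by simp
    next
      case False
      then have "min r (2 * H - r) = Suc (2 * H - Suc r)" "min (Suc r) (2 * H - Suc r) = 2 * H - Suc r"
        using r by auto
      then show ?thesis using ft fS list_adj_take_pred[of "2 * H - Suc r" x] list_adj_sym by auto
    qed
  qed
  have "legal_schedule k (list_tree A) X"
    unfolding legal_schedule_def
  proof (intro conjI allI)
    show "X 0 = replicate k (root (list_tree A))"
      by (simp add: X_def f_def map_replicate_const)
    show "legal_round (edges (list_tree A)) (X t) (X (Suc t))" for t
      unfolding legal_round_def X_def using step fA by (auto simp: list_all2_conv_all_nth)
  qed
  moreover have "exploration_time (list_tree A) X \<le> enat (2 * H * K)"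
    unfolding exploration_time_def
  proof (rule Inf_lower, safe, intro exI conjI)
    show "verts (list_tree A) \<subseteq> (\<Union>s\<le>2 * H * K. set (X s))"
    proof
      fix u assume "u \<in> verts (list_tree A)"
      then obtain x where x: "x \<in> A" "u = to_nat x" by auto
      then have "x \<in> e ` {0..<card A}" using e by (simp add: bij_betw_def)
      then obtain m where m: "m < card A" "x = e m" by auto
      \<comment> \<open>The midpoint of period \<open>m div k\<close>: agent \<open>m mod k\<close>
        then carries the prefix of length \<open>H\<close>, which is all of
        \<open>x\<close>.\<close>
      define s where "s = H + m div k * (2 * H)"
      have "m div k < K" using m(1) k \<open>k > 0\<close> by (simp add: div_less_iff_less_mult)
      then have "Suc (m div k) * (2 * H) \<le> K * (2 * H)" by (intro mult_le_mono1) simp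
      then have "s \<le> 2 * H * K" by (simp add: s_def algebra_simps)
      have s: "s mod (2 * H) = H" "s div (2 * H) = m div k"
        using H(2) by (auto simp: s_def div_mult_self1)
      have "f (m mod k) s = x"
        using H(1)[OF x(1)] m by (simp add: f_def s g_def)
      then have "u \<in> set (X s)" using x(2) \<open>k > 0\<close> by (auto simp: X_def intro!: image_eqI[of _ _ "m mod k"])
      then show "u \<in> (\<Union>s\<le>2 * H * K. set (X s))" using \<open>s \<le> 2 * H * K\<close> by blast
    qed
  qed simp
  ultimately show ?thesis
    unfolding offline_optimum_def by (intro Inf_lower2[of "exploration_time (list_tree A) X"]) auto
qed

section \<open>From the hard tree to the competitive ratio\<close>

lemma divide_mono_ennreal:
  fixes a b c d :: ennreal
  assumes "a \<le> b" "d \<le> c"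
  shows "a / c \<le> b / d"
proof -
  have "inverse c \<le> inverse d"
    using assms(2) by (simp add: less_eq_ennreal.rep_eq inverse_ennreal.rep_eq ereal_inverse_antimono)
  then show ?thesis using assms(1) unfolding divide_ennreal_def by (intro mult_mono) auto
qed

text \<open>On the hard tree the strategy needs at least \<open>h * h * L\<close> rounds, while the
  optimum is at most \<open>2 * (2 * h * L + 1) * K \<le> 6 * h * L * K\<close>; the factor
  \<open>L\<close> cancels in the quotient.\<close>

lemma competitive_ratio_ge:
  assumes strat: "exploration_strategy k S" and pos: "h > 0" "L > 0" "d > 0"
    and few: "h * h * L * k < d ^ (h + 1)" and n: "1 + 2 * h * L * d ^ h \<le> n"
    and "n \<le> K * k" and "D \<le> real L"
  shows "ennreal (real h / (6 * real K)) \<le> competitive_ratio k S (trees_of_size_height n D)"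
proof -
  obtain B where B: "tree_set B" "card B = n" "\<And>x. x \<in> B \<Longrightarrow> length x \<le> 2 * h * L + 1"
    "\<exists>x\<in>B. length x \<ge> L" "enat (h * h * L) \<le> exploration_time (list_tree B) (run k S (list_tree B))"
    using hard_tree[OF strat pos few n] by blast
  have "real L \<le> real (height (list_tree B))"
    using B(4) length_le_height[OF B(1)] le_trans by fastforce
  then have mem: "list_tree B \<in> trees_of_size_height n D"
    using B(1,2) \<open>D \<le> real L\<close> rooted_tree_list_tree card_verts_list_tree
    unfolding trees_of_size_height_def by auto
  have opt: "offline_optimum k (list_tree B) \<le> enat (2 * (2 * h * L + 1) * K)"
    using B \<open>n \<le> K * k\<close> by (intro offline_optimum_le) auto
  have "K > 0" using n \<open>n \<le> K * k\<close> by (cases K) auto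
  have hL: "1 \<le> h * L" using pos by (simp add: Suc_leI)
  have "real h / (6 * real K) \<le> real (h * h * L) / real (2 * (2 * h * L + 1) * K)"
  proof -
    have "2 * (2 * h * L + 1) * K * h \<le> 6 * K * (h * h * L)"
    proof -
      have "2 * (2 * h * L + 1) \<le> 6 * (h * L)" using hL by simp
      then have "2 * (2 * h * L + 1) * (K * h) \<le> 6 * (h * L) * (K * h)" by (rule mult_le_mono1)
      then show ?thesis by (simp add: algebra_simps)
    qed
    then have "real (2 * (2 * h * L + 1) * K * h) \<le> real (6 * K * (h * h * L))"
      by (simp only: of_nat_le_iff)
    then have "real h * real (2 * (2 * h * L + 1) * K) \<le> real (h * h * L) * (6 * real K)"
      by (simp add: algebra_simps)
    moreover have "a / b \<le> u / v" if "a * v \<le> u * b" "b > 0" "v > 0" for a b u v :: real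
      using that by (simp add: divide_simps mult.commute)
    moreover have "6 * real K > 0" "real (2 * (2 * h * L + 1) * K) > 0"
      using \<open>K > 0\<close> by (simp_all only: of_nat_0_less_iff, simp_all)
    ultimately show ?thesis by blast
  qed
  then have "ennreal (real h / (6 * real K)) \<le> ennreal (real (h * h * L) / real (2 * (2 * h * L + 1) * K))"
    by (rule ennreal_leI)
  also have "\<dots> = ennreal_of_enat (enat (h * h * L)) / ennreal_of_enat (enat (2 * (2 * h * L + 1) * K))"
    using \<open>K > 0\<close>
    by (subst divide_ennreal[symmetric]) (simp_all only: ennreal_of_enat_enat ennreal_of_nat_eq_real_of_nat of_nat_0_le_iff of_nat_0_less_iff, simp)
  also have "\<dots> \<le> ennreal_of_enat (exploration_time (list_tree B) (run k S (list_tree B))) /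
      ennreal_of_enat (offline_optimum k (list_tree B))"
    by (intro divide_mono_ennreal iffD2[OF ennreal_of_enat_le_iff] B(5) opt)
  also have "\<dots> \<le> competitive_ratio k S (trees_of_size_height n D)"
    unfolding competitive_ratio_def by (rule SUP_upper[OF mem])
  finally show ?thesis .
qed

section \<open>Choice of the parameters for large \<open>n\<close>\<close>

text \<open>Here \<open>y\<close> stands for \<open>n powr (1 / (4 * h + 4))\<close>, and \<open>d\<close> is maximal with
  \<open>1 + 2 * h * L * d ^ h \<le> n\<close>.\<close>

lemma branching_exists:
  fixes y b c :: real and h L n :: nat
  defines "b \<equiv> 4 * c * real h ^ 3 * 2 ^ h"
  assumes "h > 0" "L > 0" "c > 0" "real L \<le> 2 * y" and ny: "real n = y ^ (4 * h + 4)"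
    and y1: "1 + 4 * real h \<le> y" and y2: "4 * real h * (2 * b) ^ h * 2 ^ (2 * h + 1) \<le> y"
  shows "\<exists>d>0. 1 + 2 * h * L * d ^ h \<le> n \<and> real (h * h * L) * (c * real n) < real (d ^ (h + 1))"
proof -
  define P where "P d \<longleftrightarrow> n < 1 + 2 * h * L * d ^ h" for d
  have "y \<ge> 1" using y1 by linarith
  have "real (1 + 2 * h * L) \<le> 1 + 4 * real h * y"
    using mult_left_mono[OF \<open>real L \<le> 2 * y\<close>, of "2 * real h"] by simp
  also have "\<dots> \<le> (1 + 4 * real h) * y" using \<open>y \<ge> 1\<close> by (simp add: algebra_simps)
  also have "\<dots> \<le> y * y" using y1 \<open>y \<ge> 1\<close> by (intro mult_right_mono) auto
  also have "\<dots> = y ^ 2" by (simp add: power2_eq_square)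
  also have "\<dots> \<le> real n" unfolding ny using \<open>y \<ge> 1\<close> by (intro power_increasing) auto
  finally have "1 + 2 * h * L \<le> n" by (simp only: of_nat_le_iff)
  then have nP1: "\<not> P 1" by (simp add: P_def)
  have "n ^ 1 \<le> n ^ h" using nP1 \<open>h > 0\<close> by (intro power_increasing) (auto simp: P_def)
  moreover have "1 * n ^ h \<le> 2 * h * L * n ^ h" using \<open>h > 0\<close> \<open>L > 0\<close> by (intro mult_le_mono1) simp
  ultimately have "P n" unfolding P_def power_one_right by linarith
  then obtain m where m: "P m" "\<And>i. i < m \<Longrightarrow> \<not> P i" using ex_least_nat_le[of P n] by blast
  have "\<not> P 0" using nP1 \<open>h > 0\<close> by (cases h) (auto simp: P_def)
  then have "m \<noteq> 0" "m \<noteq> 1" using m(1) nP1 by metis+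
  define d where "d = m - 1"
  have d: "d > 0" "m = Suc d" using \<open>m \<noteq> 0\<close> \<open>m \<noteq> 1\<close> by (auto simp: d_def)
  have nP: "1 + 2 * h * L * d ^ h \<le> n" using m(2)[of d] d by (simp add: P_def)
  \<comment> \<open>Maximality of \<open>d\<close> bounds \<open>n\<close> through
    \<open>d + 1\<close>, which is at most \<open>2 * d\<close>; this is the source of the factor
    \<open>2 ^ h\<close> in \<open>b\<close>.\<close>
  have "Suc d ^ h \<le> (2 * d) ^ h" using d by (intro power_mono) auto
  then have "n < 1 + 2 * h * L * (2 * d) ^ h"
    using m(1) unfolding d(2) P_def by (meson add_left_mono less_le_trans mult_le_mono2)
  also have "\<dots> \<le> 2 * h * L * (2 * d) ^ h + 2 * h * L * (2 * d) ^ h"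
    using \<open>h > 0\<close> \<open>L > 0\<close> d(1) by (simp add: Suc_le_eq)
  also have "\<dots> = 4 * h * L * (2 * d) ^ h" by simp
  finally have "real n < real (4 * h * L * (2 * d) ^ h)" by (simp only: of_nat_less_iff)
  then have n: "real n < 4 * real h * real L * (2 * real d) ^ h" by simp
  have "b > 0" unfolding b_def using \<open>c > 0\<close> \<open>h > 0\<close> by simp
  \<comment> \<open>This is what the target inequality requires after inserting the upper bound for
    \<open>n\<close>. If it failed, \<open>n\<close> would be at most a constant times
    \<open>y ^ (2 * h + 1)\<close>, far below \<open>y ^ (4 * h + 4)\<close>.\<close>
  have "real d > b * real L ^ 2"
  proof (rule ccontr)
    assume "\<not> ?thesis"
    then have "2 * real d \<le> 2 * b * real L ^ 2" by simp
    then have "(2 * real d) ^ h \<le> (2 * b * real L ^ 2) ^ h" by (intro power_mono) auto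
    then have "real n < 4 * real h * real L * (2 * b * real L ^ 2) ^ h"
      using n by (meson less_le_trans mult_left_mono of_nat_0_le_iff mult_nonneg_nonneg zero_le_numeral)
    also have "\<dots> = 4 * real h * (2 * b) ^ h * real L ^ (2 * h + 1)"
      by (simp add: power_mult_distrib power_mult)
    also have "\<dots> \<le> 4 * real h * (2 * b) ^ h * (2 * y) ^ (2 * h + 1)"
      using \<open>b > 0\<close> \<open>real L \<le> 2 * y\<close> by (intro mult_left_mono power_mono) auto
    also have "\<dots> = (4 * real h * (2 * b) ^ h * 2 ^ (2 * h + 1)) * y ^ (2 * h + 1)"
      by (simp only: power_mult_distrib mult.assoc)
    also have "\<dots> \<le> y * y ^ (2 * h + 1)"
      using y2 \<open>y \<ge> 1\<close> by (intro mult_right_mono) auto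
    also have "\<dots> = y ^ (2 * h + 2)" by simp
    also have "\<dots> \<le> real n" unfolding ny using \<open>y \<ge> 1\<close> by (intro power_increasing) auto
    finally show False by simp
  qed
  have "real (h * h * L) * (c * real n) < real (h * h * L) * (c * (4 * real h * real L * (2 * real d) ^ h))"
    using n \<open>h > 0\<close> \<open>L > 0\<close> \<open>c > 0\<close> by (intro mult_strict_left_mono) auto
  also have "\<dots> = b * real L ^ 2 * real d ^ h"
    by (simp add: b_def power_mult_distrib power2_eq_square power3_eq_cube)
  also have "\<dots> < real d * real d ^ h"
    using \<open>real d > b * real L ^ 2\<close> d by (intro mult_strict_right_mono) auto
  finally show ?thesis using d nP by auto
qed

text \<open>As \<epsilon> tends to 0, \<open>D n\<close> eventually drops below the fixed power
  \<open>n powr \<delta>\<close>, where \<delta> is small enough for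
  \<open>branching_exists\<close>.\<close>

lemma eventually_parameters:
  fixes D \<epsilon> :: "nat \<Rightarrow> real"
  assumes "\<epsilon> \<in> o(\<lambda>_. 1)" "eventually (\<lambda>n. D n \<le> real n powr \<epsilon> n) sequentially"
    and "h > 0" "c > 0"
  shows "eventually (\<lambda>n. \<exists>L>0. \<exists>d>0. D n \<le> real L \<and> 1 + 2 * h * L * d ^ h \<le> n \<and>
    real (h * h * L) * (c * real n) < real (d ^ (h + 1))) sequentially"
proof -
  define \<delta> where "\<delta> = 1 / real (4 * h + 4)"
  define b where "b = 4 * c * real h ^ 3 * 2 ^ h"
  have "\<delta> > 0" by (simp add: \<delta>_def)
  have ev1: "eventually (\<lambda>n. \<epsilon> n \<le> \<delta>) sequentially"
    using landau_o.smallD[OF assms(1) \<open>\<delta> > 0\<close>] by eventually_elim auto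
  \<comment> \<open>The maximum of the two lower bounds that \<open>branching_exists\<close> demands
    of \<open>y\<close>.\<close>
  define C where "C = max (1 + 4 * real h) (4 * real h * (2 * b) ^ h * 2 ^ (2 * h + 1))"
  have ev2: "eventually (\<lambda>n. C \<le> real n powr \<delta>) sequentially"
    using eventually_ge_at_top[of "nat \<lceil>C powr (1 / \<delta>)\<rceil>"]
  proof eventually_elim
    case (elim n)
    then have "C powr (1 / \<delta>) \<le> real n" by linarith
    then have "(C powr (1 / \<delta>)) powr \<delta> \<le> real n powr \<delta>"
      using \<open>\<delta> > 0\<close> by (intro powr_mono2) auto
    moreover have "C > 0" by (auto simp: C_def less_max_iff_disj)
    ultimately show ?case using \<open>\<delta> > 0\<close> by (simp add: powr_powr)
  qed
  from ev1 ev2 assms(2) eventually_ge_at_top[of 1] show ?thesis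
  proof eventually_elim
    case (elim n)
    define y where "y = real n powr \<delta>"
    \<comment> \<open>The 1 keeps \<open>L\<close> positive; rounding up costs at most a factor 2
      because \<open>y\<close> is at least 1.\<close>
    define L where "L = nat \<lceil>max 1 (D n)\<rceil>"
    have "y \<ge> 1" using elim by (simp add: y_def C_def)
    have "D n \<le> y"
      using elim powr_mono[of "\<epsilon> n" \<delta> "real n"] by (simp add: y_def)
    then have L: "L > 0" "D n \<le> real L" "real L \<le> 2 * y"
      using \<open>y \<ge> 1\<close> by (auto simp: L_def) linarith+
    have "real n = y ^ (4 * h + 4)"
    proof -
      have "y ^ (4 * h + 4) = real n powr (\<delta> * real (4 * h + 4))"
        using elim by (simp only: y_def powr_power mult.commute)
      also have "\<delta> * real (4 * h + 4) = 1" unfolding \<delta>_def by (simp del: of_nat_add)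
      finally show ?thesis using elim by simp
    qed
    then have "\<exists>d>0. 1 + 2 * h * L * d ^ h \<le> n \<and> real (h * h * L) * (c * real n) < real (d ^ (h + 1))"
      using L(1,3) assms(3,4) elim(2) unfolding b_def C_def y_def[symmetric]
      by (intro branching_exists[where y = y]) simp_all
    then show ?case using L by blast
  qed
qed

theorem theorem4:
  fixes D \<epsilon> :: "nat \<Rightarrow> real" and k :: "nat \<Rightarrow> nat" and S :: "nat \<Rightarrow> strategy"
  assumes "\<epsilon> \<in> o(\<lambda>_. 1)"
    and "eventually (\<lambda>n. D n \<le> real n powr \<epsilon> n) sequentially"
    and "(\<lambda>n. real (k n)) \<in> \<Theta>(\<lambda>n. real n)"
    and "\<And>n. exploration_strategy (k n) (S n)"
  shows "(\<lambda>n. competitive_ratio (k n) (S n) (trees_of_size_height n (D n))) \<longlonglongrightarrow> \<infinity>"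
proof -
  obtain c where c: "c > 0" "eventually (\<lambda>n. real (k n) \<le> c * real n) sequentially"
    using bigthetaD1[OF assms(3)] by (auto elim!: landau_o.bigE)
  obtain c' where c': "c' > 0" "eventually (\<lambda>n. c' * real n \<le> real (k n)) sequentially"
    using bigthetaD2[OF assms(3)] by (auto elim!: landau_omega.bigE)
  \<comment> \<open>\<open>K\<close> is chosen so that eventually \<open>n \<le> K * k n\<close>,
    that is, \<open>K\<close> tours per agent cover all vertices.\<close>
  define K where "K = nat \<lceil>1 / c'\<rceil>"
  have "1 / c' \<le> real K" unfolding K_def by (rule real_nat_ceiling_ge)
  then have "1 \<le> real K * c'" using c'(1) by (simp add: pos_divide_le_eq)
  moreover from this have "K > 0" by (cases K) auto
  ultimately have K: "K > 0" "1 \<le> real K * c'" by blast+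
  have "eventually (\<lambda>n. ennreal l < competitive_ratio (k n) (S n) (trees_of_size_height n (D n))) sequentially"
    if "l \<ge> 0" for l
  proof -
    \<comment> \<open>The number of stages is fixed before \<open>n\<close> grows, large enough that
      the guaranteed ratio \<open>h / (6 * K)\<close> exceeds \<open>l\<close>.\<close>
    obtain h :: nat where h: "real h > max 1 (6 * real K * l)" using reals_Archimedean2 by blast
    then have "h > 0" and lh: "l < real h / (6 * real K)"
      using K by (auto simp: field_simps)
    from eventually_parameters[OF assms(1,2) \<open>h > 0\<close> \<open>c > 0\<close>] c(2) c'(2) show ?thesis
    proof eventually_elim
      case (elim n)
      then obtain L d where Ld: "L > 0" "d > 0" "D n \<le> real L" "1 + 2 * h * L * d ^ h \<le> n"
        "real (h * h * L) * (c * real n) < real (d ^ (h + 1))" by blast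
      have "real (h * h * L) * real (k n) \<le> real (h * h * L) * (c * real n)"
        using elim by (intro mult_left_mono) auto
      then have "real (h * h * L * k n) < real (d ^ (h + 1))" using Ld(5) by simp
      then have few: "h * h * L * k n < d ^ (h + 1)" by (simp only: of_nat_less_iff)
      have "1 * real n \<le> (real K * c') * real n" using K(2) by (intro mult_right_mono) auto
      also have "\<dots> = real K * (c' * real n)" by simp
      also have "\<dots> \<le> real K * real (k n)" using elim by (intro mult_left_mono) auto
      finally have "real n \<le> real (K * k n)" by simp
      then have "n \<le> K * k n" by (simp only: of_nat_le_iff)
      have "ennreal l < ennreal (real h / (6 * real K))"
        using lh \<open>l \<ge> 0\<close> by (simp add: ennreal_less_iff)
      also have "\<dots> \<le> competitive_ratio (k n) (S n) (trees_of_size_height n (D n))"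
        by (rule competitive_ratio_ge[OF assms(4) \<open>h > 0\<close> Ld(1,2) few Ld(4) \<open>n \<le> K * k n\<close> Ld(3)])
      finally show ?case .
    qed
  qed
  then show ?thesis
    by (simp add: tendsto_top_iff_ennreal infinity_ennreal_def)
qed

end
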